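(* Consider a choice dataset over the item set $[m]$ with distinct choice sets $S_1,\dots,S_n\subseteq[m]$, where $S_i$ appears in $R_i\ge 1$ observations and item $j$ is selected $W_j>0$ times in total. Define $p\in\mathbb{R}^n$ by $p_i=R_i$, $q\in\mathbb{R}^m$ by $q_j=W_j$, and $A\in\mathbb{R}^{n\times m}$ by $A_{ij}=1$ if $j\in S_i$ and $A_{ij}=0$ otherwise. Let $D^0\in\mathbb{R}^{m\times m}$ be a diagonal matrix with positive diagonal entries $D^0_j$ satisfying $\sum_{j=1}^m D^0_j=1$, and let $s\in\Delta_m$ be given by $s_j=D^0_j$. Then there is a diagonal matrix $D^1\in\mathbb{R}^{n\times n}$ with positive diagonal entries such that $\hat A:=D^1AD^0$ satisfies $$\hat A\,\mathbf{1}_m=p,\qquad \hat A^T\mathbf{1}_n=q,$$ if and only if $s$ satisfies the optimality conditions of the maximum likelihood estimation problem of the Luce choice model for this dataset, namely $$W_j=\sum_{i\in[n]:\,j\in S_i}R_i\,\frac{s_j}{\sum_{k\in S_i}s_k}\qquad\text{for all } j\in[m].$$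
   Context: A choice dataset over items $[m]=\{1,\dots,m\}$ is a finite list of observations, each consisting of a nonempty choice set $S\subseteq[m]$ and one selected item in $S$. Observations with identical choice sets are grouped: the distinct choice sets are $S_1,\dots,S_n$, and $R_i$ is the number of observations whose choice set is $S_i$ (the selected item may differ between these observations). $W_j$ is the number of observations in which item $j$ is selected, so $\sum_iR_i=\sum_jW_j$. In the Luce choice model with parameter $s$ in the interior of the probability simplex $\Delta_m$, item $j\in S$ is selected from $S$ with probability $s_j/\sum_{k\in S}s_k$. The displayed optimality conditions are the first-order conditions for maximizing the log-likelihood $\sum_j W_j\log s_j-\sum_i R_i\log\sum_{k\in S_i}s_k$, after multiplication by $s_j$. $\mathbf{1}_k$ is the all-ones vector in $\mathbb{R}^k$. *)

theory Defs
  imports "HOL-Analysis.Analysis"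
begin

text \<open>
  An observation is a pair of a choice set and the item selected from it. The item set
  \<open>[m]\<close> is the finite type \<open>'m\<close>.
\<close>

type_synonym 'm observation = "'m set \<times> 'm"

definition choice_dataset :: "'m observation list \<Rightarrow> bool" where
  "choice_dataset obs \<longleftrightarrow> (\<forall>(C, j) \<in> set obs. C \<noteq> {} \<and> j \<in> C)"

definition choice_sets :: "'m observation list \<Rightarrow> 'm set set" where
  "choice_sets obs = fst ` set obs"

definition num_observations :: "'m observation list \<Rightarrow> 'm set \<Rightarrow> nat" where
  "num_observations obs C = length (filter (\<lambda>ob. fst ob = C) obs)"

definition num_selections :: "'m observation list \<Rightarrow> 'm \<Rightarrow> nat" where
  "num_selections obs j = length (filter (\<lambda>ob. snd ob = j) obs)"

definition incidence_matrix :: "('n \<Rightarrow> 'm set) \<Rightarrow> real^'m^'n" where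
  "incidence_matrix S = (\<chi> i j. if j \<in> S i then 1 else 0)"

definition diagonal_matrix :: "'a::zero^'n^'n \<Rightarrow> bool" where
  "diagonal_matrix M \<longleftrightarrow> (\<forall>i j. i \<noteq> j \<longrightarrow> M $ i $ j = 0)"

definition luce_prob :: "real^'m \<Rightarrow> 'm set \<Rightarrow> 'm \<Rightarrow> real" where
  "luce_prob s C j = s $ j / (\<Sum>k\<in>C. s $ k)"

text \<open>
  The conditions below equate to zero the partial derivatives, each multiplied by \<open>s $ j\<close>, of the
  log-likelihood, which is the sum of \<open>ln (luce_prob s C j)\<close> over the observations \<open>(C, j)\<close>.
  The family \<open>S\<close> is meant to enumerate the distinct choice sets of the dataset without repetition.
\<close>

definition luce_optimality_conditions ::
    "'m observation list \<Rightarrow> ('n::finite \<Rightarrow> 'm set) \<Rightarrow> real^'m \<Rightarrow> bool" where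
  "luce_optimality_conditions obs S s \<longleftrightarrow>
     (\<forall>j. real (num_selections obs j) =
        (\<Sum>i \<in> {i. j \<in> S i}. real (num_observations obs (S i)) * luce_prob s (S i) j))"

end

theory Submission
  imports Defs
begin

text \<open>
  The row sums of \<open>D1 ** A ** D0\<close> are \<open>D1 $ i $ i * (\<Sum>k\<in>S i. s $ k)\<close>, so the row condition
  determines \<open>D1 $ i $ i = p $ i / (\<Sum>k\<in>S i. s $ k)\<close>, which is positive. With this \<open>D1\<close>, the
  column condition is literally the system of optimality conditions.
\<close>

lemma diagonal_matrix_mult_left:
  fixes D :: "'a::semiring_1^'n^'n" and M :: "'a^'m^'n"
  assumes "diagonal_matrix D"
  shows "(D ** M) $ i $ j = D $ i $ i * M $ i $ j"
proof -
  have "(D ** M) $ i $ j = (\<Sum>k\<in>UNIV. D $ i $ k * M $ k $ j)"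
    by (simp add: matrix_matrix_mult_def)
  also have "\<dots> = (\<Sum>k\<in>{i}. D $ i $ k * M $ k $ j)"
    using assms by (intro sum.mono_neutral_right) (auto simp: diagonal_matrix_def)
  finally show ?thesis by simp
qed

lemma diagonal_matrix_mult_right:
  fixes D :: "'a::semiring_1^'m^'m" and M :: "'a^'m^'n"
  assumes "diagonal_matrix D"
  shows "(M ** D) $ i $ j = M $ i $ j * D $ j $ j"
proof -
  have "(M ** D) $ i $ j = (\<Sum>k\<in>UNIV. M $ i $ k * D $ k $ j)"
    by (simp add: matrix_matrix_mult_def)
  also have "\<dots> = (\<Sum>k\<in>{j}. M $ i $ k * D $ k $ j)"
    using assms by (intro sum.mono_neutral_right) (auto simp: diagonal_matrix_def)
  finally show ?thesis by simp
qed

text \<open>The entry at \<open>(i, k)\<close> of the scaled matrix is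
  \<open>D1 $ i $ i * D0 $ k $ k\<close> if \<open>k \<in> S i\<close> and 0 otherwise. Along a row
  the first factor is constant and comes out of the sum.\<close>

lemma scaled_incidence_row_sum:
  fixes S :: "'n::finite \<Rightarrow> 'm::finite set"
  assumes "diagonal_matrix D1" and "diagonal_matrix D0"
  shows "((D1 ** incidence_matrix S ** D0) *v 1) $ i = D1 $ i $ i * (\<Sum>k\<in>S i. D0 $ k $ k)"
proof -
  have "((D1 ** incidence_matrix S ** D0) *v 1) $ i =
      (\<Sum>k\<in>UNIV. if k \<in> S i then D1 $ i $ i * D0 $ k $ k else 0)"
    by (auto simp: matrix_vector_mult_def diagonal_matrix_mult_left[OF assms(1)]
        diagonal_matrix_mult_right[OF assms(2)] incidence_matrix_def intro!: sum.cong)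
  then show ?thesis
    by (simp add: sum.If_cases sum_distrib_left)
qed

text \<open>The factor \<open>D0 $ j $ j\<close> stays under the sum so that the summands can be
  matched one by one with those of the optimality conditions.\<close>

lemma scaled_incidence_column_sum:
  fixes S :: "'n::finite \<Rightarrow> 'm::finite set"
  assumes "diagonal_matrix D1" and "diagonal_matrix D0"
  shows "(transpose (D1 ** incidence_matrix S ** D0) *v 1) $ j =
    (\<Sum>i\<in>{i. j \<in> S i}. D1 $ i $ i * D0 $ j $ j)"
proof -
  have "(transpose (D1 ** incidence_matrix S ** D0) *v 1) $ j =
      (\<Sum>i\<in>UNIV. if j \<in> S i then D1 $ i $ i * D0 $ j $ j else 0)"
    by (auto simp: matrix_vector_mult_def transpose_def diagonal_matrix_mult_left[OF assms(1)]
        diagonal_matrix_mult_right[OF assms(2)] incidence_matrix_def intro!: sum.cong)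
  then show ?thesis
    by (simp add: sum.If_cases)
qed

theorem theorem1:
  fixes obs :: "('m::finite) observation list"
    and S :: "'n::finite \<Rightarrow> 'm set"
    and p :: "real^'n" and q :: "real^'m"
    and A :: "real^'m^'n"
    and D0 :: "real^'m^'m"
    and s :: "real^'m"
  assumes "choice_dataset obs"
    and "bij_betw S UNIV (choice_sets obs)"
    and "\<And>i. num_observations obs (S i) \<ge> 1"
    and "\<And>j. num_selections obs j > 0"
    and "p = (\<chi> i. real (num_observations obs (S i)))"
    and "q = (\<chi> j. real (num_selections obs j))"
    and "A = incidence_matrix S"
    and "diagonal_matrix D0"
    and "\<And>j. D0 $ j $ j > 0"
    and "(\<Sum>j\<in>UNIV. D0 $ j $ j) = 1"
    and "s = (\<chi> j. D0 $ j $ j)"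
  shows "(\<exists>D1 :: real^'n^'n. diagonal_matrix D1 \<and> (\<forall>i. D1 $ i $ i > 0) \<and>
            (D1 ** A ** D0) *v 1 = p \<and> transpose (D1 ** A ** D0) *v 1 = q)
         \<longleftrightarrow> luce_optimality_conditions obs S s"
proof -
  let ?R = "\<lambda>i. real (num_observations obs (S i))"
  let ?sum = "\<lambda>i. \<Sum>k\<in>S i. s $ k"
  have s: "s $ j = D0 $ j $ j" "s $ j > 0" for j
    using assms(9,11) by auto
  \<comment> \<open>Choice sets of a dataset are nonempty, so the denominators of the Luce
    probabilities are positive.\<close>
  have sum_pos: "?sum i > 0" for i
  proof -
    have "S i \<in> choice_sets obs"
      using assms(2) by (auto simp: bij_betw_def)
    then have "S i \<noteq> {}"
      using assms(1) by (auto simp: choice_sets_def choice_dataset_def)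
    then show ?thesis
      using s(2) by (intro sum_pos) auto
  qed
  \<comment> \<open>The optimality conditions do not mention \<open>D1\<close>. Hence this
    equivalence, stated for every diagonal \<open>D1\<close>, leaves only a positive diagonal matrix
    with the prescribed entries to be found.\<close>
  have marginals: "(D1 ** A ** D0) *v 1 = p \<and> transpose (D1 ** A ** D0) *v 1 = q \<longleftrightarrow>
      (\<forall>i. D1 $ i $ i = ?R i / ?sum i) \<and> luce_optimality_conditions obs S s"
    if D1: "diagonal_matrix D1" for D1 :: "real^'n^'n"
  proof -
    have row: "(D1 ** A ** D0) *v 1 = p \<longleftrightarrow> (\<forall>i. D1 $ i $ i = ?R i / ?sum i)"
      using sum_pos
      by (simp add: vec_eq_iff assms(5,7) scaled_incidence_row_sum[OF D1 assms(8)] flip: s(1))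
        (metis eq_divide_eq less_irrefl)
    \<comment> \<open>Inserting the row condition turns \<open>D1 $ i $ i * s $ j\<close> into
      \<open>?R i * luce_prob s (S i) j\<close>. The simp rule
      \<open>transpose_matrix_vector\<close> would rewrite the product to \<open>v*\<close> form,
      where the column sum lemma no longer matches.\<close>
    have col: "transpose (D1 ** A ** D0) *v 1 = q \<longleftrightarrow> luce_optimality_conditions obs S s"
      if "\<forall>i. D1 $ i $ i = ?R i / ?sum i"
      using that
      by (auto simp: vec_eq_iff assms(6,7) scaled_incidence_column_sum[OF D1 assms(8)]
          luce_optimality_conditions_def luce_prob_def
          simp flip: s(1) simp del: transpose_matrix_vector)
    show ?thesis
      using row col by blast
  qed
  define D1 :: "real^'n^'n" where "D1 = (\<chi> i j. if i = j then ?R i / ?sum i else 0)"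
  have D1: "diagonal_matrix D1" and D1_diag: "D1 $ i $ i = ?R i / ?sum i" for i
    by (simp_all add: diagonal_matrix_def D1_def)
  \<comment> \<open>Every choice set is observed at least once, so the numerator is positive as
    well.\<close>
  have "D1 $ i $ i > 0" for i
    using assms(3)[of i] sum_pos[of i] by (simp add: D1_diag)
  with D1 D1_diag show ?thesis
    using marginals by blast
qed

end
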